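(* Let $\mathbf{k}\in\mathbb{R}^n$ and let $Q\in\mathbb{R}^{n\times n}$ be an orthogonal matrix that is nowhere zero. Define $$D=\{\mathbf{x}\in\mathbb{R}^n:(\mathbf{k}^TQ)\circ\mathbf{x}^T=\mathbf{0}^T\},\qquad F=\{Q^T\mathbf{y}:\mathbf{y}\in\mathbb{R}^n,\ \mathbf{k}\circ\mathbf{y}=\mathbf{0}\}.$$ If $D\cap F=\{\mathbf{0}\}$, then every super pattern of the $(n+1)\times(n+1)$ sign pattern $$\begin{bmatrix}1 & \operatorname{sgn}(\mathbf{k}^TQ)\\ -\operatorname{sgn}(\mathbf{k}) & \operatorname{sgn}(Q)\end{bmatrix}$$ allows orthogonality.
   Context: All matrices are real; $\circ$ is the Hadamard product; nowhere zero means all entries nonzero. A sign pattern is a $(0,1,-1)$-matrix; $\operatorname{sgn}$ is applied entrywise. A square sign pattern $T$ allows orthogonality if there is a real orthogonal matrix with sign pattern $T$. For sign patterns $S=[s_{ij}]$, $R=[r_{ij}]$ of the same size, $S_{\vec R}$ has $(i,j)$-entry $s_{ij}$ if $s_{ij}\neq0$ and $r_{ij}$ otherwise; a super pattern of $S$ is any sign pattern of the form $S_{\vec R}$. *)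

theory Defs
  imports "HOL-Analysis.Analysis"
begin

definition nowhere_zero :: "real^'n^'m \<Rightarrow> bool" where
  "nowhere_zero A \<longleftrightarrow> (\<forall>i j. A $ i $ j \<noteq> 0)"

definition sign_pattern :: "real^'n^'m \<Rightarrow> bool" where
  "sign_pattern S \<longleftrightarrow> (\<forall>i j. S $ i $ j \<in> {0, 1, -1})"

text \<open>The library function \<^const>\<open>sgn\<close> on vectors is normalization, not the entrywise sign.\<close>

definition sgn_vec :: "real^'n \<Rightarrow> real^'n" where
  "sgn_vec v = (\<chi> i. sgn (v $ i))"

definition sgn_mat :: "real^'n^'m \<Rightarrow> real^'n^'m" where
  "sgn_mat A = (\<chi> i j. sgn (A $ i $ j))"

definition allows_orthogonality :: "real^'n^'n \<Rightarrow> bool" where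
  "allows_orthogonality T \<longleftrightarrow> (\<exists>P. orthogonal_matrix P \<and> sgn_mat P = T)"

definition pattern_fill :: "real^'n^'m \<Rightarrow> real^'n^'m \<Rightarrow> real^'n^'m" where
  "pattern_fill S R = (\<chi> i j. if S $ i $ j \<noteq> 0 then S $ i $ j else R $ i $ j)"

definition super_pattern :: "real^'n^'m \<Rightarrow> real^'n^'m \<Rightarrow> bool" where
  "super_pattern T S \<longleftrightarrow> (\<exists>R. sign_pattern R \<and> T = pattern_fill S R)"

text \<open>
  The block matrix with scalar corner \<open>a\<close>, first row \<open>r\<close>, first column \<open>c\<close> and lower right
  block \<open>M\<close>. The index type \<open>'n option\<close> has one element more than \<open>'n\<close>; \<^const>\<open>None\<close> is the
  index of the extra row and column.
\<close>

definition bordered :: "real \<Rightarrow> real^'n \<Rightarrow> real^'n \<Rightarrow> real^'n^'n \<Rightarrow> real^('n option)^('n option)"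
where
  "bordered a r c M = (\<chi> i j.
     case i of
       None \<Rightarrow> (case j of None \<Rightarrow> a | Some j' \<Rightarrow> r $ j')
     | Some i' \<Rightarrow> (case j of None \<Rightarrow> c $ i' | Some j' \<Rightarrow> M $ i' $ j'))"

end

theory Submission
  imports Defs
begin

text \<open>
  For \<open>v \<in> \<real>\<^sup>n\<close> and \<open>t = v \<bullet> v\<close>, reflecting in the hyperplane orthogonal to \<open>(1, v)\<close>, negating the
  first row and multiplying by \<open>1 \<oplus> Q\<close> gives an orthogonal matrix whose first row is a positive
  multiple of \<open>v\<^sup>TQ\<close> off the corner and whose first column is a negative multiple of \<open>v\<close>; for small
  \<open>v\<close> its corner is positive and its remaining block has the signs of \<open>Q\<close>. Hence it is enough to
  perturb \<open>k\<close> to some \<open>u = k + \<delta>w\<close> such that \<open>u\<close> and \<open>u\<^sup>TQ\<close> have prescribed signs where \<open>k\<close> and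
  \<open>k\<^sup>TQ\<close> vanish. The linear system for \<open>w\<close> is solvable since \<open>D \<inter> F = {0}\<close> says that the adjoint
  map is injective.
\<close>

lemma sum_option: "(\<Sum>j\<in>UNIV. f j) = f None + (\<Sum>j\<in>UNIV. f (Some j))"
  for f :: "'n::finite option \<Rightarrow> 'a::comm_monoid_add"
  by (simp add: UNIV_option_conv sum.reindex)

lemma bordered_nth [simp]:
  "bordered a r c M $ None $ None = a"
  "bordered a r c M $ None $ Some j = r $ j"
  "bordered a r c M $ Some i $ None = c $ i"
  "bordered a r c M $ Some i $ Some j = M $ i $ j"
  by (simp_all add: bordered_def)

text \<open>Orthonormality is checked row by row: an inner product of two rows is the product of
  their entries in column \<open>None\<close> plus a sum over the \<open>Some\<close> columns.
  \<open>row_row\<close>, \<open>top_row\<close> and \<open>top_top\<close> evaluate these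
  sums.\<close>

lemma orthogonal_matrix_bordered:
  fixes Q :: "real^'n^'n" and v :: "real^'n"
  defines "t \<equiv> v \<bullet> v"
  assumes "orthogonal_matrix Q"
  shows "orthogonal_matrix
    (bordered ((1 - t) / (1 + t)) ((2 / (1 + t)) *\<^sub>R (v v* Q)) (- (2 / (1 + t)) *\<^sub>R v)
      (\<chi> i j. Q $ i $ j - 2 / (1 + t) * v $ i * (v v* Q) $ j))"
    (is "orthogonal_matrix ?P")
proof -
  define r where "r = v v* Q"
  define s where "s = 1 / (1 + t)"
  have "t \<ge> 0" by (simp add: t_def)
  \<comment> \<open>The relation \<open>s * t = 1 - s\<close> is what makes the terms quadratic in
    \<open>s\<close> collapse in the three sums below.\<close>
  hence st: "s * t = 1 - s" and frac: "2 / (1 + t) = 2 * s" "(1 - t) / (1 + t) = 2 * s - 1"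
    by (simp_all add: s_def field_simps)
  have QQ: "Q ** transpose Q = mat 1"
    using assms(2) by (simp add: orthogonal_matrix_def)
  have Qr: "Q *v r = v"
    by (metis QQ matrix_vector_mul_assoc matrix_vector_mul_lid r_def transpose_matrix_vector)
  have Qr': "(\<Sum>j\<in>UNIV. Q $ i $ j * r $ j) = v $ i" for i
    using Qr by (auto simp: matrix_vector_mult_def vec_eq_iff)
  have "r \<bullet> r = v \<bullet> (Q *v r)"
    by (simp add: dot_lmul_matrix r_def)
  hence rr: "(\<Sum>j\<in>UNIV. r $ j * r $ j) = t"
    by (simp add: Qr t_def inner_vec_def)
  have QQ': "(\<Sum>j\<in>UNIV. Q $ i $ j * Q $ l $ j) = (if i = l then 1 else 0)" for i l
    using arg_cong[OF QQ, of "\<lambda>M. M $ i $ l"]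
    by (simp add: matrix_matrix_mult_def transpose_def mat_def)
  \<comment> \<open>The defect \<open>- 4 * s\<^sup>2 * v $ i * v $ l\<close> is compensated by the
    product of the first-column entries \<open>- 2 * s * v $ i\<close> and
    \<open>- 2 * s * v $ l\<close>.\<close>
  have row_row: "(\<Sum>j\<in>UNIV. (Q $ i $ j - 2 * s * v $ i * r $ j) * (Q $ l $ j - 2 * s * v $ l * r $ j))
      = (if i = l then 1 else 0) - 4 * s\<^sup>2 * v $ i * v $ l" for i l
  proof -
    have "(\<Sum>j\<in>UNIV. (Q $ i $ j - 2 * s * v $ i * r $ j) * (Q $ l $ j - 2 * s * v $ l * r $ j))
      = (\<Sum>j\<in>UNIV. Q $ i $ j * Q $ l $ j) - 2 * s * v $ l * (\<Sum>j\<in>UNIV. Q $ i $ j * r $ j)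
        - 2 * s * v $ i * (\<Sum>j\<in>UNIV. Q $ l $ j * r $ j)
        + 4 * s * s * v $ i * v $ l * (\<Sum>j\<in>UNIV. r $ j * r $ j)"
      by (simp add: sum_distrib_left flip: sum.distrib sum_subtractf)
        (intro sum.cong refl, simp add: algebra_simps)
    also have "\<dots> = (if i = l then 1 else 0) - 4 * s * v $ i * v $ l
        + 4 * s * v $ i * v $ l * (s * t)"
      unfolding QQ' Qr' rr by (simp add: algebra_simps)
    finally show ?thesis
      by (simp add: st algebra_simps power2_eq_square)
  qed
  have top_row: "(\<Sum>j\<in>UNIV. 2 * s * r $ j * (Q $ i $ j - 2 * s * v $ i * r $ j))
      = 2 * s * v $ i * (2 * s - 1)" for i
  proof -
    have "(\<Sum>j\<in>UNIV. 2 * s * r $ j * (Q $ i $ j - 2 * s * v $ i * r $ j))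
      = 2 * s * (\<Sum>j\<in>UNIV. Q $ i $ j * r $ j) - 4 * s * s * v $ i * (\<Sum>j\<in>UNIV. r $ j * r $ j)"
      by (simp add: sum_distrib_left flip: sum_subtractf)
        (intro sum.cong refl, simp add: algebra_simps)
    also have "\<dots> = 2 * s * v $ i - 4 * s * v $ i * (s * t)"
      unfolding Qr' rr by (simp add: algebra_simps)
    finally show ?thesis
      by (simp add: st algebra_simps)
  qed
  have top_top: "(\<Sum>j\<in>UNIV. 2 * s * r $ j * (2 * s * r $ j)) = 4 * s * (1 - s)"
  proof -
    have "(\<Sum>j\<in>UNIV. 2 * s * r $ j * (2 * s * r $ j)) = 4 * s * s * (\<Sum>j\<in>UNIV. r $ j * r $ j)"
      by (simp add: sum_distrib_left) (intro sum.cong refl, simp add: algebra_simps)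
    also have "\<dots> = 4 * s * (s * t)" by (simp add: rr)
    finally show ?thesis by (simp add: st)
  qed
  have "(?P ** transpose ?P) $ a $ b = (mat 1 :: real^'n option^'n option) $ a $ b" for a b
  proof (cases a; cases b)
    assume "a = None" "b = None"
    thus ?thesis
      using top_top
      by (simp add: matrix_matrix_mult_def transpose_def mat_def sum_option frac flip: r_def)
        (simp add: algebra_simps power2_eq_square)
  next
    fix i assume "a = None" "b = Some i"
    thus ?thesis
      using top_row[of i]
      by (simp add: matrix_matrix_mult_def transpose_def mat_def sum_option frac flip: r_def)
  next
    fix i assume "a = Some i" "b = None"
    thus ?thesis
      using top_row[of i]
      by (simp add: matrix_matrix_mult_def transpose_def mat_def sum_option frac mult.commute flip: r_def)
  next
    fix i l assume "a = Some i" "b = Some l"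
    thus ?thesis
      using row_row[of i l]
      by (simp add: matrix_matrix_mult_def transpose_def mat_def sum_option frac power2_eq_square
          flip: r_def)
  qed
  hence "?P ** transpose ?P = mat 1" by (simp add: vec_eq_iff)
  thus ?thesis
    by (simp add: orthogonal_matrix_def matrix_left_right_inverse)
qed

text \<open>A Fredholm argument: the linear map \<open>L\<close> reads off the coordinates to be
  prescribed, and it hits every target because its adjoint
  \<open>(y, x) \<mapsto> y + Q *v x\<close>, on pairs supported on the zero sets of
  \<open>k\<close> and \<open>h\<close>, is injective by the hypothesis
  \<open>trivial\<close>.\<close>

lemma prescribe_on_zero_sets:
  fixes k h a b :: "real^'n" and Q :: "real^'n^'n"
  assumes "orthogonal_matrix Q"
    and trivial: "\<And>y. k * y = 0 \<Longrightarrow> h * (transpose Q *v y) = 0 \<Longrightarrow> y = 0"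
  obtains w where "\<And>i. k $ i = 0 \<Longrightarrow> w $ i = a $ i" and "\<And>j. h $ j = 0 \<Longrightarrow> (w v* Q) $ j = b $ j"
proof -
  define p where "p c x = (\<chi> i. if c $ i = 0 then x $ i else 0)" for c x :: "real^'n"
  define L where "L w = (p k w, p h (w v* Q))" for w
  have p_lin: "p c (x + y) = p c x + p c y" "p c (q *\<^sub>R x) = q *\<^sub>R p c x" for c x y q
    by (simp_all add: p_def vec_eq_iff)
  have "linear L"
    by (rule linearI)
      (simp_all add: L_def p_lin vector_matrix_left_distrib scaleR_vector_matrix_assoc)
  hence sub: "subspace (range L)" by (simp add: linear_subspace_image)
  \<comment> \<open>The target splits into a part \<open>s = L w\<close> in the range and a residual
    \<open>z\<close> orthogonal to it. Once \<open>z = 0\<close> is shown, this \<open>w\<close> is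
    the solution.\<close>
  obtain s z where s: "s \<in> span (range L)" and z: "\<And>x. x \<in> span (range L) \<Longrightarrow> orthogonal z x"
    and sz: "(p k a, p h b) = s + z"
    using orthogonal_subspace_decomp_exists by blast
  obtain w where w: "s = L w" using s sub by (metis imageE span_eq_iff)
  obtain y x where yx: "z = (y, x)" by (cases z)
  have y: "y = p k (a - w)" and x: "x = p h (b - w v* Q)"
    using sz by (auto simp: w yx L_def p_def vec_eq_iff split: if_splits)
  have p_inner: "p c m \<bullet> p c l = p c m \<bullet> l" for c m l
    by (auto simp: p_def inner_vec_def intro!: sum.cong)
  \<comment> \<open>Orthogonality of \<open>z\<close> to the range says that the adjoint of
    \<open>L\<close> kills \<open>z\<close>. The projections drop out by \<open>p_inner\<close>, as
    \<open>y\<close> and \<open>x\<close> are already projected.\<close>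
  have "(y + Q *v x) \<bullet> l = 0" for l
  proof -
    have "z \<bullet> L l = 0"
      using z[of "L l"] by (simp add: orthogonal_def span_base)
    hence "y \<bullet> l + x \<bullet> (l v* Q) = 0"
      by (simp add: yx L_def y x p_inner)
    thus ?thesis
      by (simp add: inner_add_left inner_commute[of x] inner_commute[of _ l] dot_lmul_matrix inner_add_right)
  qed
  hence "y + Q *v x = 0" by (metis inner_eq_zero_iff)
  hence yQ: "y = - (Q *v x)" by (simp add: eq_neg_iff_add_eq_0)
  have QQx: "transpose Q *v (Q *v x) = x"
    using assms(1) by (simp add: orthogonal_matrix_def matrix_vector_mul_assoc)
  have "transpose Q *v y = - (transpose Q *v (Q *v x))"
    unfolding yQ by (rule linear_neg[OF matrix_vector_mul_linear])
  hence Qy: "transpose Q *v y = - x"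
    unfolding QQx .
  have "y = 0"
  proof (rule trivial)
    show "k * y = 0" by (simp add: y p_def vec_eq_iff)
    show "h * (transpose Q *v y) = 0" unfolding Qy by (simp add: x p_def vec_eq_iff)
  qed
  with Qy have "x = 0" by simp
  show thesis
  proof (rule that)
    show "w $ i = a $ i" if "k $ i = 0" for i
      using \<open>y = 0\<close> that by (auto simp: y p_def vec_eq_iff split: if_splits)
    show "(w v* Q) $ j = b $ j" if "h $ j = 0" for j
      using \<open>x = 0\<close> that by (auto simp: x p_def vec_eq_iff split: if_splits)
  qed
qed

lemma eventually_sgn_eq:
  fixes f :: "'a \<Rightarrow> real"
  assumes "(f \<longlongrightarrow> L) G" "L \<noteq> 0"
  shows "eventually (\<lambda>x. sgn (f x) = sgn L) G"
proof (cases "L > 0")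
  case True
  show ?thesis
    using order_tendstoD(1)[OF assms(1) True] by eventually_elim (simp add: True)
next
  case False
  hence "L < 0" using assms(2) by simp
  show ?thesis
    using order_tendstoD(2)[OF assms(1) \<open>L < 0\<close>] by eventually_elim (simp add: \<open>L < 0\<close>)
qed

text \<open>The filter is one-sided because for \<open>c = 0\<close> the sign of
  \<open>\<delta> * d\<close> is that of \<open>d\<close> only when \<open>\<delta>\<close> is
  positive.\<close>

lemma eventually_sgn_perturb:
  fixes c d :: real
  shows "\<forall>\<^sub>F \<delta> in at_right 0. sgn (c + \<delta> * d) = (if c = 0 then sgn d else sgn c)"
proof (cases "c = 0")
  case True
  show ?thesis
    using eventually_at_right_less[of "0::real"] by eventually_elim (simp add: True sgn_mult)
next
  case False
  have "((\<lambda>\<delta>. c + \<delta> * d) \<longlongrightarrow> c + 0 * d) (at_right 0)"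
    by (intro tendsto_intros)
  from eventually_sgn_eq[OF this] False show ?thesis by simp
qed

text \<open>Scaling \<open>u\<close> by \<open>e > 0\<close> leaves the signs of \<open>u\<close>
  and \<open>u v* Q\<close> alone, while the block tends to \<open>Q\<close> as \<open>e\<close>
  tends to 0. Its limit entries are nonzero, so their signs persist for small
  \<open>e\<close>.\<close>

lemma allows_orthogonality_bordered:
  fixes Q :: "real^'n^'n" and u :: "real^'n"
  assumes "orthogonal_matrix Q" "nowhere_zero Q"
  shows "allows_orthogonality (bordered 1 (sgn_vec (u v* Q)) (- sgn_vec u) (sgn_mat Q))"
proof -
  let ?t = "\<lambda>e. (e *\<^sub>R u) \<bullet> (e *\<^sub>R u)"
  let ?B = "\<lambda>e i j. Q $ i $ j - 2 / (1 + ?t e) * (e *\<^sub>R u) $ i * ((e *\<^sub>R u) v* Q) $ j"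
  have t0: "(?t \<longlongrightarrow> ?t 0) (at_right 0)"
    by (intro tendsto_intros)
  have corner: "\<forall>\<^sub>F e in at_right 0. ?t e < 1"
    by (rule order_tendstoD(2)[OF t0]) simp
  have "\<forall>\<^sub>F e in at_right 0. sgn (?B e i j) = sgn (Q $ i $ j)" for i j
  proof -
    have "((\<lambda>e. ?B e i j) \<longlongrightarrow> ?B 0 i j) (at_right 0)"
      unfolding scaleR_vector_matrix_assoc vector_scaleR_component
      by (intro tendsto_intros) auto
    from eventually_sgn_eq[OF this] show ?thesis
      using assms(2) by (simp add: nowhere_zero_def)
  qed
  hence block: "\<forall>\<^sub>F e in at_right 0. \<forall>i j. sgn (?B e i j) = sgn (Q $ i $ j)"
    by (simp add: eventually_all_finite)
  have "\<forall>\<^sub>F e in at_right (0::real). e > 0 \<and> ?t e < 1 \<and> (\<forall>i j. sgn (?B e i j) = sgn (Q $ i $ j))"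
    using eventually_at_right_less corner block by (intro eventually_conj) auto
  then obtain e :: real where e: "e > 0" "?t e < 1" "\<And>i j. sgn (?B e i j) = sgn (Q $ i $ j)"
    using eventually_happens'[OF trivial_limit_at_right_real] by blast
  define t where "t = ?t e"
  have t: "0 \<le> t" "t < 1" using e(2) by (simp_all add: t_def del: inner_scaleR_left inner_scaleR_right)
  hence pos: "1 + t > 0" "1 - t > 0" by simp_all
  let ?P = "bordered ((1 - t) / (1 + t)) ((2 / (1 + t)) *\<^sub>R ((e *\<^sub>R u) v* Q))
      (- (2 / (1 + t)) *\<^sub>R (e *\<^sub>R u)) (\<chi> i j. ?B e i j)"
  have "orthogonal_matrix ?P"
    unfolding t_def by (rule orthogonal_matrix_bordered[OF assms(1)])
  moreover have "sgn_mat ?P $ a $ b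
      = bordered 1 (sgn_vec (u v* Q)) (- sgn_vec u) (sgn_mat Q) $ a $ b" for a b
  proof (cases a; cases b)
    fix i j assume "a = Some i" "b = Some j"
    thus ?thesis using e(3)[of i j] by (simp add: sgn_mat_def t_def)
  qed (use e(1) pos in \<open>simp_all add: sgn_mat_def sgn_vec_def sgn_mult sgn_divide sgn_minus
        scaleR_vector_matrix_assoc\<close>)
  hence "sgn_mat ?P = bordered 1 (sgn_vec (u v* Q)) (- sgn_vec u) (sgn_mat Q)"
    by (simp only: vec_eq_iff) blast
  ultimately show ?thesis
    unfolding allows_orthogonality_def by blast
qed

theorem corollary6p10:
  fixes k :: "real^'n" and Q :: "real^'n^'n" and D F :: "(real^'n) set"
  assumes "orthogonal_matrix Q"
    and "nowhere_zero Q"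
    and "D = {x. (k v* Q) * x = 0}"
    and "F = {transpose Q *v y | y. k * y = 0}"
    and "D \<inter> F = {0}"
  shows "\<forall>T. super_pattern T (bordered 1 (sgn_vec (k v* Q)) (- sgn_vec k) (sgn_mat Q))
           \<longrightarrow> allows_orthogonality T"
proof (intro allI impI)
  fix T assume "super_pattern T (bordered 1 (sgn_vec (k v* Q)) (- sgn_vec k) (sgn_mat Q))"
  then obtain R where R: "sign_pattern R"
    and T: "T = pattern_fill (bordered 1 (sgn_vec (k v* Q)) (- sgn_vec k) (sgn_mat Q)) R"
    by (auto simp: super_pattern_def)
  \<comment> \<open>Entries of \<open>R\<close> are their own signs, so they can serve directly as
    values of the perturbation; an entry 0 keeps the perturbed coordinate at 0.\<close>
  have sgn_R: "sgn (R $ i $ j) = R $ i $ j" for i j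
    using R[unfolded sign_pattern_def, rule_format, of i j] by auto
  have trivial: "y = 0" if "k * y = 0" "(k v* Q) * (transpose Q *v y) = 0" for y
  proof -
    have "transpose Q *v y \<in> D \<inter> F" using that assms(3,4) by auto
    hence "transpose Q *v y = 0" using assms(5) by simp
    hence "Q *v (transpose Q *v y) = 0" by simp
    thus ?thesis
      using assms(1) by (simp add: orthogonal_matrix_def matrix_vector_mul_assoc del: transpose_matrix_vector)
  qed
  \<comment> \<open>The minus sign matches the first column of the pattern, which is
    \<open>- sgn_vec u\<close>.\<close>
  obtain w where w: "\<And>i. k $ i = 0 \<Longrightarrow> w $ i = - R $ Some i $ None"
    "\<And>j. (k v* Q) $ j = 0 \<Longrightarrow> (w v* Q) $ j = R $ None $ Some j"
    using prescribe_on_zero_sets[OF assms(1) trivial,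
        where a = "\<chi> i. - R $ Some i $ None" and b = "\<chi> j. R $ None $ Some j"]
    by auto
  have "\<forall>\<^sub>F \<delta> in at_right (0::real).
      (\<forall>i. sgn (k $ i + \<delta> * w $ i) = (if k $ i = 0 then sgn (w $ i) else sgn (k $ i))) \<and>
      (\<forall>j. sgn ((k v* Q) $ j + \<delta> * (w v* Q) $ j)
        = (if (k v* Q) $ j = 0 then sgn ((w v* Q) $ j) else sgn ((k v* Q) $ j)))"
    by (intro eventually_conj eventually_all_finite eventually_sgn_perturb)
  then obtain \<delta> :: real where
    \<delta>: "\<And>i. sgn (k $ i + \<delta> * w $ i) = (if k $ i = 0 then sgn (w $ i) else sgn (k $ i))"
      "\<And>j. sgn ((k v* Q) $ j + \<delta> * (w v* Q) $ j)
        = (if (k v* Q) $ j = 0 then sgn ((w v* Q) $ j) else sgn ((k v* Q) $ j))"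
    using eventually_happens'[OF trivial_limit_at_right_real] by blast
  define u where "u = k + \<delta> *\<^sub>R w"
  have uQ: "(u v* Q) $ j = (k v* Q) $ j + \<delta> * (w v* Q) $ j" for j
    by (simp add: u_def vector_matrix_left_distrib scaleR_vector_matrix_assoc)
  \<comment> \<open>The corner and the block of the original pattern have no zeros, so
    \<open>R\<close> fills in only the first row and the first column, where \<open>w\<close> was
    prescribed.\<close>
  have "T $ a $ b = bordered 1 (sgn_vec (u v* Q)) (- sgn_vec u) (sgn_mat Q) $ a $ b" for a b
  proof (cases a; cases b)
    fix j assume "a = None" "b = Some j"
    thus ?thesis
      using \<delta>(2)[of j] w(2)[of j] by (simp add: T pattern_fill_def sgn_vec_def uQ sgn_R sgn_zero_iff)
  next
    fix i assume "a = Some i" "b = None"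
    thus ?thesis
      using \<delta>(1)[of i] w(1)[of i]
      by (simp add: T pattern_fill_def sgn_vec_def u_def sgn_R sgn_minus sgn_zero_iff)
  next
    fix i j assume "a = Some i" "b = Some j"
    thus ?thesis
      using assms(2) by (simp add: T pattern_fill_def sgn_mat_def nowhere_zero_def sgn_zero_iff)
  qed (simp add: T pattern_fill_def)
  hence "T = bordered 1 (sgn_vec (u v* Q)) (- sgn_vec u) (sgn_mat Q)"
    by (simp add: vec_eq_iff)
  thus "allows_orthogonality T"
    using allows_orthogonality_bordered[OF assms(1,2)] by simp
qed

end
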